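(* For every cograph $G$, $\chi_a(G)=\mathrm{tw}(G)+1$.
   Context: Cographs: a single vertex is a cograph; disjoint unions and joins (disjoint union plus all edges between distinct parts) of cographs are cographs. $\chi_a(G)$ is the minimum number of colors in an acyclic coloring, i.e. a proper vertex coloring in which the union of any two color classes induces a forest. A triangulation of $G=(V,E)$ is a chordal graph $(V,E^+)$ with $E\subseteq E^+$; the treewidth $\mathrm{tw}(G)$ is the minimum of $\omega(G^+)-1$ over all triangulations $G^+$ of $G$, where $\omega$ denotes the clique number. *)

theory Defs
  imports Main "HOL-Library.Ramsey"
begin

type_synonym 'a graph = "'a set \<times> 'a set set"

abbreviation verts :: "'a graph \<Rightarrow> 'a set" where "verts \<equiv> fst"
abbreviation edges :: "'a graph \<Rightarrow> 'a set set" where "edges \<equiv> snd"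

definition simple_graph :: "'a graph \<Rightarrow> bool" where
  "simple_graph G \<longleftrightarrow> finite (verts G) \<and> edges G \<subseteq> [verts G]\<^bsup>2\<^esup>"

definition induced :: "'a graph \<Rightarrow> 'a set \<Rightarrow> 'a graph" where
  "induced G U = (verts G \<inter> U, {e \<in> edges G. e \<subseteq> U})"

definition cross_edges :: "'a graph set \<Rightarrow> 'a set set" where
  "cross_edges \<S> =
     {{x, y} | x y. \<exists>G\<in>\<S>. \<exists>H\<in>\<S>. G \<noteq> H \<and> x \<in> verts G \<and> y \<in> verts H}"

text \<open>Unions and joins are taken over finite nonempty families of graphs on pairwise disjoint
  vertex sets; every cograph is therefore finite and nonempty. Since the vertex names are
  arbitrary, the class is closed under isomorphism.\<close>

inductive cograph :: "'a graph \<Rightarrow> bool" where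
  single: "cograph ({v}, {})"
| disjoint_union:
    "finite \<S> \<Longrightarrow> \<S> \<noteq> {} \<Longrightarrow> (\<And>G. G \<in> \<S> \<Longrightarrow> cograph G) \<Longrightarrow>
     (\<And>G H. G \<in> \<S> \<Longrightarrow> H \<in> \<S> \<Longrightarrow> G \<noteq> H \<Longrightarrow> verts G \<inter> verts H = {}) \<Longrightarrow>
     cograph (\<Union>G\<in>\<S>. verts G, \<Union>G\<in>\<S>. edges G)"
| join:
    "finite \<S> \<Longrightarrow> \<S> \<noteq> {} \<Longrightarrow> (\<And>G. G \<in> \<S> \<Longrightarrow> cograph G) \<Longrightarrow>
     (\<And>G H. G \<in> \<S> \<Longrightarrow> H \<in> \<S> \<Longrightarrow> G \<noteq> H \<Longrightarrow> verts G \<inter> verts H = {}) \<Longrightarrow>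
     cograph (\<Union>G\<in>\<S>. verts G, (\<Union>G\<in>\<S>. edges G) \<union> cross_edges \<S>)"

definition is_cycle :: "'a graph \<Rightarrow> 'a list \<Rightarrow> bool" where
  "is_cycle G xs \<longleftrightarrow> length xs \<ge> 3 \<and> distinct xs \<and> set xs \<subseteq> verts G \<and>
     (\<forall>i<length xs. {xs ! i, xs ! (Suc i mod length xs)} \<in> edges G)"

definition forest :: "'a graph \<Rightarrow> bool" where
  "forest G \<longleftrightarrow> (\<nexists>xs. is_cycle G xs)"

definition has_chord :: "'a graph \<Rightarrow> 'a list \<Rightarrow> bool" where
  "has_chord G xs \<longleftrightarrow>
     (\<exists>i<length xs. \<exists>j<length xs. i \<noteq> j \<and>
        j \<noteq> Suc i mod length xs \<and> i \<noteq> Suc j mod length xs \<and> {xs ! i, xs ! j} \<in> edges G)"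

definition chordal :: "'a graph \<Rightarrow> bool" where
  "chordal G \<longleftrightarrow> (\<forall>xs. is_cycle G xs \<and> length xs \<ge> 4 \<longrightarrow> has_chord G xs)"

definition proper_coloring :: "'a graph \<Rightarrow> ('a \<Rightarrow> nat) \<Rightarrow> bool" where
  "proper_coloring G c \<longleftrightarrow>
     (\<forall>x\<in>verts G. \<forall>y\<in>verts G. x \<noteq> y \<and> {x, y} \<in> edges G \<longrightarrow> c x \<noteq> c y)"

definition color_class :: "'a graph \<Rightarrow> ('a \<Rightarrow> nat) \<Rightarrow> nat \<Rightarrow> 'a set" where
  "color_class G c i = {x \<in> verts G. c x = i}"

definition acyclic_coloring :: "'a graph \<Rightarrow> ('a \<Rightarrow> nat) \<Rightarrow> bool" where
  "acyclic_coloring G c \<longleftrightarrow> proper_coloring G c \<and>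
     (\<forall>i j. forest (induced G (color_class G c i \<union> color_class G c j)))"

definition acyclic_chromatic_number :: "'a graph \<Rightarrow> nat" (\<open>\<chi>\<^sub>a\<close>) where
  "\<chi>\<^sub>a G = (LEAST k. \<exists>c. acyclic_coloring G c \<and> card (c ` verts G) = k)"

definition clique_number :: "'a graph \<Rightarrow> nat" (\<open>\<omega>\<close>) where
  "\<omega> G = Max {card K | K. K \<subseteq> verts G \<and> clique K (edges G)}"

definition triangulation :: "'a graph \<Rightarrow> 'a graph \<Rightarrow> bool" where
  "triangulation G H \<longleftrightarrow>
     simple_graph H \<and> verts H = verts G \<and> edges G \<subseteq> edges H \<and> chordal H"

text \<open>The subtraction does not truncate on graphs with at least one vertex.\<close>

definition treewidth :: "'a graph \<Rightarrow> nat" (\<open>tw\<close>) where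
  "tw G = (LEAST k. \<exists>H. triangulation G H \<and> \<omega> H - 1 = k)"

lemma simple_graph_Union:
  assumes "finite \<S>" "\<And>G. G \<in> \<S> \<Longrightarrow> simple_graph G"
  shows "finite (\<Union>G\<in>\<S>. verts G)" "(\<Union>G\<in>\<S>. edges G) \<subseteq> [\<Union>G\<in>\<S>. verts G]\<^bsup>2\<^esup>"
proof -
  show "finite (\<Union>G\<in>\<S>. verts G)"
    using assms unfolding simple_graph_def by blast
  show "(\<Union>G\<in>\<S>. edges G) \<subseteq> [\<Union>G\<in>\<S>. verts G]\<^bsup>2\<^esup>"
  proof (rule UN_least)
    fix G assume G: "G \<in> \<S>"
    then have "edges G \<subseteq> [verts G]\<^bsup>2\<^esup>"
      using assms(2) unfolding simple_graph_def by blast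
    also have "\<dots> \<subseteq> [\<Union>G\<in>\<S>. verts G]\<^bsup>2\<^esup>"
      by (rule nsets_mono) (use G in blast)
    finally show "edges G \<subseteq> [\<Union>G\<in>\<S>. verts G]\<^bsup>2\<^esup>" .
  qed
qed

lemma cograph_simple_graph:
  assumes "cograph G"
  shows "simple_graph G" and "verts G \<noteq> {}"
proof -
  have "simple_graph G \<and> verts G \<noteq> {}"
    using assms
  proof induction
    case (single v)
    then show ?case by (simp add: simple_graph_def)
  next
    case (disjoint_union \<S>)
    have ne: "(\<Union>G\<in>\<S>. verts G) \<noteq> {}"
    proof -
      obtain G where "G \<in> \<S>" using disjoint_union.hyps(2) by blast
      then show ?thesis using disjoint_union.IH[of G] by blast
    qed
    have IH: "simple_graph G" if "G \<in> \<S>" for G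
      using disjoint_union.IH[OF that] by (rule conjunct1)
    note U = simple_graph_Union[OF disjoint_union.hyps(1) IH]
    show ?case
      unfolding simple_graph_def fst_conv snd_conv
      by (intro conjI ne U)
  next
    case (join \<S>)
    have cross: "cross_edges \<S> \<subseteq> [\<Union>G\<in>\<S>. verts G]\<^bsup>2\<^esup>"
    proof
      fix e assume "e \<in> cross_edges \<S>"
      then obtain x y G H where *: "e = {x, y}" "G \<in> \<S>" "H \<in> \<S>" "G \<noteq> H"
        "x \<in> verts G" "y \<in> verts H"
        unfolding cross_edges_def by blast
      have "x \<noteq> y" using join.hyps(4)[OF *(2-4)] *(5,6) by blast
      moreover have "{x, y} \<subseteq> (\<Union>G\<in>\<S>. verts G)" using * by blast
      ultimately show "e \<in> [\<Union>G\<in>\<S>. verts G]\<^bsup>2\<^esup>"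
        unfolding nsets_def *(1) by simp
    qed
    have ne: "(\<Union>G\<in>\<S>. verts G) \<noteq> {}"
    proof -
      obtain G where "G \<in> \<S>" using join.hyps(2) by blast
      then show ?thesis using join.IH[of G] by blast
    qed
    have IH: "simple_graph G" if "G \<in> \<S>" for G
      using join.IH[OF that] by (rule conjunct1)
    note U = simple_graph_Union[OF join.hyps(1) IH]
    show ?case
      unfolding simple_graph_def fst_conv snd_conv
      by (intro conjI ne U Un_least cross)
  qed
  then show "simple_graph G" and "verts G \<noteq> {}" by blast+
qed

end

theory Submission
  imports Defs
begin

text \<open>Acyclic colorings and triangulations of a cograph obey the same recursion. In a disjoint
  union, cycles and cliques stay inside one part. In a join, two nonadjacent (or equally colored)
  vertices in each of two parts would give a chordless (or two-colored) 4-cycle. Hence all parts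
  but at most one are cliques of a given triangulation, respectively rainbow in a given acyclic
  coloring. Conversely, a triangulation or an acyclic coloring of one part extends to the whole
  join by making every other vertex universal, respectively giving it a private color. By
  structural induction, an acyclic coloring with \<open>k\<close> colors can therefore be exchanged for a
  triangulation of clique number at most \<open>k\<close>, and vice versa.\<close>

section \<open>Cycles and induced subgraphs\<close>

text \<open>Every edge of a cycle joins two of its own vertices, so passing to an induced subgraph
  that contains these vertices loses none of its edges.\<close>

lemma is_cycle_induced_iff: "is_cycle (induced G U) xs \<longleftrightarrow> is_cycle G xs \<and> set xs \<subseteq> U"
proof -
  have "{xs ! i, xs ! (Suc i mod length xs)} \<subseteq> set xs" if "i < length xs" for i
  proof -
    have "Suc i mod length xs < length xs" using that by (intro mod_less_divisor) auto
    then show ?thesis using that by simp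
  qed
  then show ?thesis
    unfolding is_cycle_def induced_def fst_conv snd_conv by blast
qed

lemma has_chord_induced_iff:
  assumes "set xs \<subseteq> U"
  shows "has_chord (induced G U) xs \<longleftrightarrow> has_chord G xs"
proof -
  have "{xs ! i, xs ! j} \<subseteq> U" if "i < length xs" "j < length xs" for i j
    using that assms nth_mem by blast
  then show ?thesis unfolding has_chord_def induced_def snd_conv by blast
qed

text \<open>Walk around the cycle from \<open>x\<close>: an edge that meets \<open>A\<close> lies in
  \<open>A\<close>, so membership passes from each vertex to its successor.\<close>

lemma is_cycle_subset_component:
  assumes cyc: "is_cycle G xs"
    and closed: "\<And>e. e \<in> edges G \<Longrightarrow> e \<inter> A \<noteq> {} \<Longrightarrow> e \<subseteq> A"
    and x: "x \<in> set xs" "x \<in> A"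
  shows "set xs \<subseteq> A"
proof -
  let ?n = "length xs"
  obtain k where k: "k < ?n" "xs ! k = x" using x(1) by (auto simp: in_set_conv_nth)
  have edge: "{xs ! i, xs ! (Suc i mod ?n)} \<in> edges G" if "i < ?n" for i
    using cyc that unfolding is_cycle_def by blast
  have *: "xs ! ((k + m) mod ?n) \<in> A" for m
  proof (induction m)
    case 0
    then show ?case using k x by simp
  next
    case (Suc m)
    have "(k + m) mod ?n < ?n" using k by (intro mod_less_divisor) auto
    from closed[OF edge[OF this]] Suc show ?case by (simp add: mod_Suc_eq)
  qed
  show ?thesis
  proof
    fix y assume "y \<in> set xs"
    then obtain j where j: "j < ?n" "xs ! j = y" by (auto simp: in_set_conv_nth)
    \<comment> \<open>Position \<open>j\<close> is reached from \<open>k\<close> by running to the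
      end of the list and then \<open>j\<close> places further.\<close>
    have "(k + (?n - k + j)) mod ?n = j" using j k by simp
    then show "y \<in> A" using *[of "?n - k + j"] j by simp
  qed
qed

lemma is_cycle_four:
  assumes "distinct [a, b, a', b']" "{a, b, a', b'} \<subseteq> verts G"
    and "{a, b} \<in> edges G" "{b, a'} \<in> edges G" "{a', b'} \<in> edges G" "{b', a} \<in> edges G"
  shows "is_cycle G [a, b, a', b']"
proof -
  let ?xs = "[a, b, a', b']"
  have len: "length ?xs = 4" by simp
  have "{?xs ! i, ?xs ! (Suc i mod 4)} \<in> edges G" if "i < 4" for i
  proof -
    from that have "i = 0 \<or> i = 1 \<or> i = 2 \<or> i = 3" by linarith
    then show ?thesis using assms(3-) by (elim disjE) simp_all
  qed
  then show ?thesis using assms(1,2) unfolding is_cycle_def len by simp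
qed

text \<open>Modulo 4 the only pairs of positions that are distinct and not consecutive are 0, 2 and
  1, 3, the two diagonals.\<close>

lemma has_chord_four:
  assumes "has_chord G [a, b, a', b']"
  shows "{a, a'} \<in> edges G \<or> {b, b'} \<in> edges G"
proof -
  have len: "length [a, b, a', b'] = 4" by simp
  obtain i j where ij: "i < 4" "j < 4" "i \<noteq> j" "j \<noteq> Suc i mod 4" "i \<noteq> Suc j mod 4"
    and e: "{[a, b, a', b'] ! i, [a, b, a', b'] ! j} \<in> edges G"
    using assms unfolding has_chord_def len by blast
  have "i = 0 \<or> i = 1 \<or> i = 2 \<or> i = 3" "j = 0 \<or> j = 1 \<or> j = 2 \<or> j = 3"
    using ij(1,2) by linarith+
  then have "i = 0 \<and> j = 2 \<or> i = 2 \<and> j = 0 \<or> i = 1 \<and> j = 3 \<or> i = 3 \<and> j = 1"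
    using ij(3-5) by (elim disjE) simp_all
  then show ?thesis using e by (auto simp: insert_commute)
qed

text \<open>A cycle in the subgraph induced by two color classes is a cycle of \<open>G\<close> that
  shows only those two colors. This form speaks of cycles of \<open>G\<close> alone, which suits
  restriction, gluing and extension of colorings.\<close>

lemma acyclic_coloring_iff:
  "acyclic_coloring G c \<longleftrightarrow>
     proper_coloring G c \<and> (\<forall>xs i j. is_cycle G xs \<longrightarrow> \<not> c ` set xs \<subseteq> {i, j})"
proof -
  have "set xs \<subseteq> color_class G c i \<union> color_class G c j \<longleftrightarrow> c ` set xs \<subseteq> {i, j}"
    if "is_cycle G xs" for xs i j
    using that unfolding is_cycle_def color_class_def by blast
  then show ?thesis
    unfolding acyclic_coloring_def forest_def is_cycle_induced_iff by blast
qed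

lemma acyclic_coloring_induced:
  assumes "acyclic_coloring G c"
  shows "acyclic_coloring (induced G U) c"
  using assms unfolding acyclic_coloring_iff is_cycle_induced_iff
  by (auto simp: proper_coloring_def induced_def)

lemma chordal_induced:
  assumes "chordal G"
  shows "chordal (induced G U)"
  using assms unfolding chordal_def is_cycle_induced_iff by (auto simp: has_chord_induced_iff)

text \<open>Chordality is hereditary, so a triangulation of a union or join restricts to one of each
  part; this feeds the induction hypothesis.\<close>

lemma triangulation_induced:
  assumes "triangulation G H"
  shows "triangulation (induced G U) (induced H U)"
proof -
  have "simple_graph (induced H U)"
    using assms unfolding triangulation_def simple_graph_def
    by (fastforce simp: induced_def nsets_def)
  then show ?thesis
    using assms chordal_induced[of H U] unfolding triangulation_def by (auto simp: induced_def)
qed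

lemma triangulation_finite: "triangulation G H \<Longrightarrow> finite (verts H)"
  unfolding triangulation_def simple_graph_def by blast

section \<open>Clique numbers\<close>

lemma finite_clique_cards:
  assumes "finite (verts G)"
  shows "finite {card K | K. K \<subseteq> verts G \<and> clique K (edges G)}"
proof -
  have "{card K | K. K \<subseteq> verts G \<and> clique K (edges G)} \<subseteq> card ` Pow (verts G)" by blast
  then show ?thesis using assms finite_subset by blast
qed

lemma card_le_clique_number:
  assumes "finite (verts G)" "K \<subseteq> verts G" "clique K (edges G)"
  shows "card K \<le> \<omega> G"
  unfolding clique_number_def
  by (rule Max_ge[OF finite_clique_cards[OF assms(1)]]) (use assms in blast)

lemma clique_number_attained:
  assumes "finite (verts G)"
  obtains K where "K \<subseteq> verts G" "clique K (edges G)" "card K = \<omega> G"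
proof -
  \<comment> \<open>The empty clique gives \<open>Max\<close> a nonempty set, even on a graph
    without vertices.\<close>
  have "{} \<subseteq> verts G \<and> clique {} (edges G)" by (simp add: clique_def)
  then have "{card K | K. K \<subseteq> verts G \<and> clique K (edges G)} \<noteq> {}" by blast
  from Max_in[OF finite_clique_cards[OF assms] this] show ?thesis
    using that unfolding clique_number_def by auto
qed

lemma clique_number_pos:
  assumes "finite (verts G)" "verts G \<noteq> {}"
  shows "0 < \<omega> G"
proof -
  obtain v where "v \<in> verts G" using assms by blast
  then show ?thesis
    using card_le_clique_number[OF assms(1), of "{v}"] by (simp add: clique_def)
qed

lemma clique_number_induced_le:
  assumes "finite (verts G)"
  shows "\<omega> (induced G U) \<le> \<omega> G"
proof -
  have "finite (verts (induced G U))" using assms by (simp add: induced_def)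
  then obtain K where "K \<subseteq> verts (induced G U)" "clique K (edges (induced G U))"
    "card K = \<omega> (induced G U)" by (rule clique_number_attained)
  then show ?thesis
    using card_le_clique_number[OF assms, of K] by (auto simp: induced_def clique_def)
qed

section \<open>Completely adjacent vertex sets\<close>

text \<open>A repeated color on each side would yield a 4-cycle alternating between the sides and
  showing two colors only.\<close>

lemma acyclic_coloring_inj_on_or:
  assumes "acyclic_coloring G c" "A \<subseteq> verts G" "B \<subseteq> verts G" "A \<inter> B = {}"
    and adj: "\<And>a b. a \<in> A \<Longrightarrow> b \<in> B \<Longrightarrow> {a, b} \<in> edges G"
  shows "inj_on c A \<or> inj_on c B"
proof (rule ccontr)
  assume "\<not> ?thesis"
  then obtain a a' b b' where *: "a \<in> A" "a' \<in> A" "a \<noteq> a'" "c a = c a'"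
    "b \<in> B" "b' \<in> B" "b \<noteq> b'" "c b = c b'"
    unfolding inj_on_def by blast
  have "is_cycle G [a, b, a', b']"
    using * assms(2-4) adj by (intro is_cycle_four) (auto simp: insert_commute)
  moreover have "c ` set [a, b, a', b'] \<subseteq> {c a, c b}" using * by simp
  ultimately show False using assms(1) unfolding acyclic_coloring_iff by blast
qed

text \<open>A nonadjacent pair on each side would yield a 4-cycle whose two diagonals are exactly
  the missing edges.\<close>

lemma chordal_clique_or:
  assumes "chordal G" "A \<subseteq> verts G" "B \<subseteq> verts G" "A \<inter> B = {}"
    and adj: "\<And>a b. a \<in> A \<Longrightarrow> b \<in> B \<Longrightarrow> {a, b} \<in> edges G"
  shows "clique A (edges G) \<or> clique B (edges G)"
proof (rule ccontr)
  assume "\<not> ?thesis"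
  then obtain a a' b b' where *: "a \<in> A" "a' \<in> A" "a \<noteq> a'" "{a, a'} \<notin> edges G"
    "b \<in> B" "b' \<in> B" "b \<noteq> b'" "{b, b'} \<notin> edges G"
    unfolding clique_def by blast
  have "is_cycle G [a, b, a', b']"
    using * assms(2-4) adj by (intro is_cycle_four) (auto simp: insert_commute)
  then have "has_chord G [a, b, a', b']" using assms(1) unfolding chordal_def by auto
  from has_chord_four[OF this] show False using *(4,8) by blast
qed

section \<open>Extension from a part of the vertices\<close>

text \<open>All vertices of \<open>B\<close> are made universal. A long cycle inside
  \<open>A\<close> has a chord in \<open>H\<close>, and one that meets \<open>B\<close> has a chord
  at a universal vertex. A clique splits into a clique of \<open>H\<close> and a subset of
  \<open>B\<close>, which bounds the clique number.\<close>

lemma triangulation_extend: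
  assumes G: "simple_graph G" and V: "verts G = A \<union> B" "A \<inter> B = {}"
    and HA: "triangulation (induced G A) H"
  obtains H' where "triangulation G H'" "\<omega> H' \<le> \<omega> H + card B"
proof -
  let ?E = "edges H \<union> {e \<in> [verts G]\<^bsup>2\<^esup>. e \<inter> B \<noteq> {}}"
  let ?H = "(verts G, ?E)"
  have VH: "verts H = A" and EH: "edges H \<subseteq> [A]\<^bsup>2\<^esup>" and chH: "chordal H"
    and sub: "{e \<in> edges G. e \<subseteq> A} \<subseteq> edges H"
    using HA V unfolding triangulation_def simple_graph_def induced_def by auto
  have fin: "finite (verts G)" "edges G \<subseteq> [verts G]\<^bsup>2\<^esup>"
    using G unfolding simple_graph_def by auto
  have "[A]\<^bsup>2\<^esup> \<subseteq> [verts G]\<^bsup>2\<^esup>" by (rule nsets_mono) (use V in blast)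
  then have simple: "simple_graph ?H" using EH fin unfolding simple_graph_def by auto
  have edges_sub: "edges G \<subseteq> ?E"
  proof
    fix e assume e: "e \<in> edges G"
    then have "e \<subseteq> A \<union> B" using fin V by (auto simp: nsets_def)
    then show "e \<in> ?E" using e sub fin by blast
  qed
  \<comment> \<open>Every added edge meets \<open>B\<close>, so the restriction to \<open>A\<close>
    gives back \<open>H\<close> and its chordality.\<close>
  have ind: "induced ?H A = H"
  proof (rule prod_eqI)
    show "verts (induced ?H A) = verts H" using V VH by (auto simp: induced_def)
    show "edges (induced ?H A) = edges H"
      using V(2) EH by (auto simp: induced_def nsets_def)
  qed
  have univ: "{b, x} \<in> ?E" if "b \<in> B" "x \<in> verts G" "x \<noteq> b" for b x
    using that V by (auto simp: nsets_def)
  have "chordal ?H"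
    unfolding chordal_def
  proof (intro allI impI, elim conjE)
    fix xs assume cyc: "is_cycle ?H xs" and len: "4 \<le> length xs"
    have dist: "distinct xs" and xsV: "set xs \<subseteq> verts G"
      using cyc unfolding is_cycle_def by auto
    show "has_chord ?H xs"
    proof (cases "set xs \<subseteq> A")
      case True
      then have "is_cycle (induced ?H A) xs" using cyc is_cycle_induced_iff by blast
      then have "has_chord (induced ?H A) xs" using chH len ind unfolding chordal_def by simp
      then show ?thesis using has_chord_induced_iff[OF True] by blast
    next
      case False
      then obtain k where k: "k < length xs" "xs ! k \<in> B"
        using xsV V(1) by (metis UnE in_set_conv_nth subsetD subsetI)
      \<comment> \<open>The position two places after \<open>k\<close>, cyclically. As the length is
        at least 4, it is neither \<open>k\<close> nor next to \<open>k\<close> on the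
        cycle.\<close>
      define j where "j = (if k + 2 < length xs then k + 2 else k + 2 - length xs)"
      have j: "j < length xs" "k \<noteq> j" "j \<noteq> Suc k mod length xs" "k \<noteq> Suc j mod length xs"
        using k len unfolding j_def by (auto simp: mod_Suc)
      have "xs ! j \<noteq> xs ! k" using j k dist by (simp add: nth_eq_iff_index_eq)
      moreover have "xs ! j \<in> verts G" using xsV j(1) by auto
      ultimately have "{xs ! k, xs ! j} \<in> ?E" using univ[OF k(2)] by blast
      then show ?thesis unfolding has_chord_def using j k(1) by auto
    qed
  qed
  then have "triangulation G ?H"
    using simple edges_sub unfolding triangulation_def by simp
  moreover have "\<omega> ?H \<le> \<omega> H + card B"
  proof -
    obtain K where K: "K \<subseteq> verts G" "clique K ?E" "card K = \<omega> ?H"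
      using clique_number_attained[of ?H] fin(1) by auto
    have finA: "finite A" and finB: "finite B" using fin(1) V(1) by auto
    have "clique (K \<inter> A) (edges H)"
      using K(2) V(2) unfolding clique_def by auto
    then have "card (K \<inter> A) \<le> \<omega> H" using card_le_clique_number[of H] VH finA by auto
    moreover have "card (K \<inter> B) \<le> card B" using finB by (auto intro: card_mono)
    moreover have "card K \<le> card (K \<inter> A) + card (K \<inter> B)"
    proof -
      have "K = (K \<inter> A) \<union> (K \<inter> B)" using K(1) V(1) by blast
      then show ?thesis by (metis card_Un_le)
    qed
    ultimately show ?thesis using K(3) by linarith
  qed
  ultimately show ?thesis using that by blast
qed

text \<open>Each vertex of \<open>B\<close> receives a private color. On a cycle through such a
  vertex, the next two vertices avoid its color and, being adjacent, differ from each other, so at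
  least three colors appear.\<close>

lemma acyclic_coloring_extend:
  assumes G: "simple_graph G" and V: "verts G = A \<union> B" "A \<inter> B = {}"
    and c: "acyclic_coloring (induced G A) c" "c ` A \<subseteq> {..<m}"
  obtains c' where "acyclic_coloring G c'" "c' ` verts G \<subseteq> {..<m + card B}"
proof -
  have "finite B" using G V(1) unfolding simple_graph_def by auto
  then obtain f where f: "bij_betw f B {0..<card B}" using ex_bij_betw_finite_nat by blast
  \<comment> \<open>The colors on \<open>A\<close> lie below \<open>m\<close>; the offset
    \<open>m\<close> keeps the private colors apart from them, and \<open>f\<close> numbers
    \<open>B\<close> from 0.\<close>
  define c' where "c' x = (if x \<in> A then c x else m + f x)" for x
  have f_lt: "f b < card B" if "b \<in> B" for b using f that by (auto simp: bij_betw_def)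
  have fresh: "x = b" if "b \<in> B" "x \<in> verts G" "c' x = c' b" for x b
  proof -
    have "b \<notin> A" using that(1) V(2) by blast
    then have "x \<notin> A" using that(3) c(2) unfolding c'_def by (auto split: if_splits)
    then have "x \<in> B" "f x = f b" using that V(1) \<open>b \<notin> A\<close> unfolding c'_def by auto
    then show ?thesis using f that(1) by (auto simp: bij_betw_def inj_on_def)
  qed
  have proper: "c' x \<noteq> c' y"
    if "x \<in> verts G" "y \<in> verts G" "x \<noteq> y" "{x, y} \<in> edges G" for x y
  proof (cases "x \<in> A \<and> y \<in> A")
    case True
    then have "c x \<noteq> c y"
      using c(1) that unfolding acyclic_coloring_def proper_coloring_def induced_def by auto
    then show ?thesis using True by (simp add: c'_def)
  next
    case False
    then have "x \<in> B \<or> y \<in> B" using that V(1) by blast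
    then show ?thesis using fresh that by metis
  qed
  have "\<not> c' ` set xs \<subseteq> {i, j}" if cyc: "is_cycle G xs" for xs i j
  proof
    assume two: "c' ` set xs \<subseteq> {i, j}"
    have len: "3 \<le> length xs" and dist: "distinct xs" and xsV: "set xs \<subseteq> verts G"
      and edge: "\<And>i. i < length xs \<Longrightarrow> {xs ! i, xs ! (Suc i mod length xs)} \<in> edges G"
      using cyc unfolding is_cycle_def by auto
    show False
    proof (cases "set xs \<subseteq> A")
      case True
      then have "is_cycle (induced G A) xs" using cyc is_cycle_induced_iff by blast
      moreover have "c ` set xs \<subseteq> {i, j}" using two True by (auto simp: c'_def)
      ultimately show False using c(1) unfolding acyclic_coloring_iff by blast
    next
      case False
      then obtain k where k: "k < length xs" "xs ! k \<in> B"
        using xsV V(1) by (metis UnE in_set_conv_nth subsetD subsetI)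
      \<comment> \<open>\<open>s\<close> and \<open>t\<close> are the two positions after
        \<open>k\<close>; length at least 3 makes all three distinct. The edge from \<open>s\<close>
        to \<open>t\<close> separates their colors, and the color at \<open>k\<close> is
        private.\<close>
      define s where "s = Suc k mod length xs"
      define t where "t = Suc s mod length xs"
      have st: "s < length xs" "t < length xs" "s \<noteq> k" "t \<noteq> k" "s \<noteq> t"
        using k len unfolding s_def t_def by (auto simp: mod_Suc)
      have "xs ! s \<noteq> xs ! k" "xs ! t \<noteq> xs ! k" "xs ! s \<noteq> xs ! t"
        using st k dist by (simp_all add: nth_eq_iff_index_eq)
      moreover have inV: "xs ! k \<in> verts G" "xs ! s \<in> verts G" "xs ! t \<in> verts G"
        using st k xsV by auto
      ultimately have "c' (xs ! s) \<noteq> c' (xs ! k)" "c' (xs ! t) \<noteq> c' (xs ! k)"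
        "c' (xs ! s) \<noteq> c' (xs ! t)"
        using fresh[OF k(2)] proper edge[OF st(1)] unfolding t_def[symmetric] by blast+
      moreover have "{c' (xs ! k), c' (xs ! s), c' (xs ! t)} \<subseteq> {i, j}"
        using two st(1,2) k(1) nth_mem by blast
      ultimately show False by auto
    qed
  qed
  then have "acyclic_coloring G c'"
    using proper unfolding acyclic_coloring_iff proper_coloring_def by blast
  moreover have "c' ` verts G \<subseteq> {..<m + card B}"
    using c(2) f_lt V(1) unfolding c'_def by fastforce
  ultimately show ?thesis using that by blast
qed

section \<open>Disjoint families of graphs\<close>

text \<open>The common setting of both closure rules for cographs. Being stated for arbitrary simple
  graphs, it also covers the family of triangulations of the parts.\<close>

locale disjoint_family_of_graphs =
  fixes \<S> :: "'a graph set"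
  assumes finite_family: "finite \<S>"
    and simple: "G \<in> \<S> \<Longrightarrow> simple_graph G"
    and disjoint: "G \<in> \<S> \<Longrightarrow> H \<in> \<S> \<Longrightarrow> G \<noteq> H \<Longrightarrow> verts G \<inter> verts H = {}"
begin

text \<open>This graph and \<open>full_join\<close> repeat the conclusions of the rules
  \<open>disjoint_union\<close> and \<open>join\<close>, so unfolding them yields the goals of the
  induction.\<close>

definition graph_union :: "'a graph" where
  "graph_union = (\<Union>G\<in>\<S>. verts G, \<Union>G\<in>\<S>. edges G)"

definition full_join :: "'a graph" where
  "full_join = (\<Union>G\<in>\<S>. verts G, (\<Union>G\<in>\<S>. edges G) \<union> cross_edges \<S>)"

lemma edge_subset: "G \<in> \<S> \<Longrightarrow> e \<in> edges G \<Longrightarrow> e \<subseteq> verts G \<and> e \<noteq> {}"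
  using simple[of G] unfolding simple_graph_def nsets_def by fastforce

lemma edge_unique:
  assumes "G \<in> \<S>" "H \<in> \<S>" "e \<in> edges H" "e \<inter> verts G \<noteq> {}"
  shows "H = G"
  using assms edge_subset[of H e] disjoint[of H G] by blast

lemma induced_union:
  assumes "G \<in> \<S>"
  shows "induced graph_union (verts G) = G"
proof (rule prod_eqI)
  show "verts (induced graph_union (verts G)) = verts G"
    using assms by (auto simp: induced_def graph_union_def)
  show "edges (induced graph_union (verts G)) = edges G"
  proof
    show "edges (induced graph_union (verts G)) \<subseteq> edges G"
    proof
      fix e assume "e \<in> edges (induced graph_union (verts G))"
      then obtain H where H: "H \<in> \<S>" "e \<in> edges H" "e \<subseteq> verts G"
        unfolding induced_def graph_union_def by auto
      then have "e \<inter> verts G \<noteq> {}" using edge_subset by blast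
      then show "e \<in> edges G" using edge_unique[OF assms H(1,2)] H(2) by blast
    qed
    show "edges G \<subseteq> edges (induced graph_union (verts G))"
      using assms edge_subset[OF assms] unfolding induced_def graph_union_def by auto
  qed
qed

text \<open>A cross edge has ends in two different parts, hence never both in \<open>G\<close>. Only
  the edges of the disjoint union remain, and \<open>induced_union\<close> applies.\<close>

lemma induced_full_join:
  assumes "G \<in> \<S>"
  shows "induced full_join (verts G) = G"
proof (rule prod_eqI)
  show "verts (induced full_join (verts G)) = verts G"
    using assms by (auto simp: induced_def full_join_def)
  have "\<not> e \<subseteq> verts G" if e: "e \<in> cross_edges \<S>" for e
  proof
    assume "e \<subseteq> verts G"
    then obtain x y H H' where "x \<in> verts G" "y \<in> verts G" "H \<in> \<S>" "H' \<in> \<S>" "H \<noteq> H'"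
      "x \<in> verts H" "y \<in> verts H'"
      using e unfolding cross_edges_def by blast
    then show False using disjoint assms by blast
  qed
  then have "edges (induced full_join (verts G)) = edges (induced graph_union (verts G))"
    unfolding induced_def full_join_def graph_union_def by auto
  then show "edges (induced full_join (verts G)) = edges G"
    using induced_union[OF assms] by simp
qed

section \<open>Disjoint unions: cycles, cliques, triangulations and colorings part by part\<close>

lemma union_closed:
  assumes "G \<in> \<S>" "e \<in> edges graph_union" "e \<inter> verts G \<noteq> {}"
  shows "e \<subseteq> verts G"
proof -
  obtain H where "H \<in> \<S>" "e \<in> edges H" using assms(2) unfolding graph_union_def by auto
  then show ?thesis using edge_unique[of G H e] edge_subset assms by blast
qed

text \<open>The part containing the first vertex is closed under adjacency by
  \<open>union_closed\<close>, so the cycle never leaves it.\<close>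

lemma is_cycle_union:
  assumes "is_cycle graph_union xs"
  obtains G where "G \<in> \<S>" "set xs \<subseteq> verts G" "is_cycle G xs"
proof -
  have "xs \<noteq> []" "set xs \<subseteq> verts graph_union" using assms unfolding is_cycle_def by auto
  then have "hd xs \<in> verts graph_union" using hd_in_set by blast
  then obtain G where G: "G \<in> \<S>" "hd xs \<in> verts G" unfolding graph_union_def by auto
  have "set xs \<subseteq> verts G"
    by (rule is_cycle_subset_component[OF assms union_closed[OF G(1)] _ G(2)])
      (use \<open>xs \<noteq> []\<close> in auto)
  moreover from this have "is_cycle G xs"
    using is_cycle_induced_iff[of graph_union "verts G" xs] assms induced_union[OF G(1)] by simp
  ultimately show ?thesis using that G by blast
qed

lemma chordal_union:
  assumes "\<And>G. G \<in> \<S> \<Longrightarrow> chordal G"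
  shows "chordal graph_union"
  unfolding chordal_def
proof (intro allI impI, elim conjE)
  fix xs assume "is_cycle graph_union xs" and len: "4 \<le> length xs"
  then obtain G where G: "G \<in> \<S>" "set xs \<subseteq> verts G" "is_cycle G xs"
    using is_cycle_union by blast
  then have "has_chord G xs" using assms len unfolding chordal_def by blast
  then show "has_chord graph_union xs"
    using has_chord_induced_iff[OF G(2), of graph_union] induced_union[OF G(1)] by simp
qed

lemma simple_graph_union: "simple_graph graph_union"
  using simple_graph_Union[OF finite_family simple]
  unfolding simple_graph_def graph_union_def by simp

text \<open>All vertices of a clique are equal or adjacent to one fixed vertex \<open>x\<close> of
  it, hence lie in the part of \<open>x\<close>.\<close>

lemma clique_number_union_le:
  assumes "\<And>G. G \<in> \<S> \<Longrightarrow> \<omega> G \<le> n"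
  shows "\<omega> graph_union \<le> n"
proof -
  have "finite (verts graph_union)" using simple_graph_union unfolding simple_graph_def by blast
  then obtain K where K: "K \<subseteq> verts graph_union" "clique K (edges graph_union)"
    "card K = \<omega> graph_union"
    by (rule clique_number_attained)
  show ?thesis
  proof (cases "K = {}")
    case True
    then show ?thesis using K(3) by simp
  next
    case False
    then obtain x where x: "x \<in> K" by blast
    then have "x \<in> verts graph_union" using K(1) by blast
    then obtain G where G: "G \<in> \<S>" "x \<in> verts G" unfolding graph_union_def by auto
    have KG: "K \<subseteq> verts G"
    proof
      fix y assume "y \<in> K"
      then have "y = x \<or> {x, y} \<in> edges graph_union" using x K(2) unfolding clique_def by metis
      then show "y \<in> verts G" using G union_closed[OF G(1), of "{x, y}"] by auto
    qed
    have "{e \<in> edges graph_union. e \<subseteq> verts G} = edges G"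
      using arg_cong[OF induced_union[OF G(1)], of edges] unfolding induced_def by simp
    then have "clique K (edges G)"
      using K(2) KG unfolding clique_def by blast
    moreover have "finite (verts G)" using simple[OF G(1)] unfolding simple_graph_def by blast
    ultimately show ?thesis using card_le_clique_number[OF _ KG] assms[OF G(1)] K(3) by force
  qed
qed

lemma acyclic_coloring_union:
  assumes "\<And>G. G \<in> \<S> \<Longrightarrow> acyclic_coloring G c"
  shows "acyclic_coloring graph_union c"
  unfolding acyclic_coloring_iff
proof (intro conjI allI impI)
  show "proper_coloring graph_union c"
    unfolding proper_coloring_def
  proof (intro ballI impI, elim conjE)
    fix x y assume *: "x \<noteq> y" "{x, y} \<in> edges graph_union"
    then obtain G where G: "G \<in> \<S>" "{x, y} \<in> edges G" unfolding graph_union_def by auto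
    then have "x \<in> verts G" "y \<in> verts G" using edge_subset by blast+
    then show "c x \<noteq> c y"
      using assms[OF G(1)] G(2) *(1) unfolding acyclic_coloring_iff proper_coloring_def by blast
  qed
  fix xs i j assume "is_cycle graph_union xs"
  then obtain G where "G \<in> \<S>" "is_cycle G xs" using is_cycle_union by blast
  then show "\<not> c ` set xs \<subseteq> {i, j}" using assms unfolding acyclic_coloring_iff by blast
qed

lemma union_triangulation:
  assumes "\<And>G. G \<in> \<S> \<Longrightarrow> \<exists>H. triangulation G H \<and> \<omega> H \<le> n"
  shows "\<exists>H. triangulation graph_union H \<and> \<omega> H \<le> n"
proof -
  obtain T where T: "\<And>G. G \<in> \<S> \<Longrightarrow> triangulation G (T G)" "\<And>G. G \<in> \<S> \<Longrightarrow> \<omega> (T G) \<le> n"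
    using assms by metis
  have VT: "verts (T G) = verts G" "edges G \<subseteq> edges (T G)" "simple_graph (T G)" "chordal (T G)"
    if "G \<in> \<S>" for G
    using T(1)[OF that] unfolding triangulation_def by auto
  \<comment> \<open>Triangulating keeps vertex sets, so the images of distinct parts stay disjoint
    and the facts about unions apply to them.\<close>
  interpret T: disjoint_family_of_graphs "T ` \<S>"
  proof
    show "finite (T ` \<S>)" using finite_family by simp
    show "simple_graph H" if "H \<in> T ` \<S>" for H using that VT by auto
    show "verts H \<inter> verts H' = {}" if HH': "H \<in> T ` \<S>" "H' \<in> T ` \<S>" "H \<noteq> H'" for H H'
    proof -
      obtain G G' where "G \<in> \<S>" "G' \<in> \<S>" "H = T G" "H' = T G'" using HH'(1,2) by blast
      then show ?thesis using HH'(3) VT(1) disjoint[of G G'] by metis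
    qed
  qed
  have "verts T.graph_union = verts graph_union" "edges graph_union \<subseteq> edges T.graph_union"
    using VT(1,2) unfolding T.graph_union_def graph_union_def by (simp, fastforce)
  moreover have "chordal T.graph_union" by (rule T.chordal_union) (use VT(4) in auto)
  ultimately have "triangulation graph_union T.graph_union"
    using T.simple_graph_union unfolding triangulation_def by simp
  moreover have "\<omega> T.graph_union \<le> n" by (rule T.clique_number_union_le) (use T(2) in auto)
  ultimately show ?thesis by blast
qed

text \<open>The parts all draw from the same palette \<open>{..<n}\<close>, so their colorings glue
  without new colors.\<close>

lemma union_acyclic_coloring:
  assumes "\<And>G. G \<in> \<S> \<Longrightarrow> \<exists>c. acyclic_coloring G c \<and> c ` verts G \<subseteq> {..<n}"
  shows "\<exists>c. acyclic_coloring graph_union c \<and> c ` verts graph_union \<subseteq> {..<n}"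
proof -
  obtain C where C: "\<And>G. G \<in> \<S> \<Longrightarrow> acyclic_coloring G (C G)"
    "\<And>G. G \<in> \<S> \<Longrightarrow> C G ` verts G \<subseteq> {..<n}"
    using assms by metis
  \<comment> \<open>Disjointness makes the part containing \<open>x\<close> unique; each vertex
    takes its color from there.\<close>
  define c where "c x = C (THE G. G \<in> \<S> \<and> x \<in> verts G) x" for x
  have c: "c x = C G x" if "G \<in> \<S>" "x \<in> verts G" for G x
  proof -
    have "(THE G. G \<in> \<S> \<and> x \<in> verts G) = G"
      by (rule the_equality) (use that disjoint in blast)+
    then show ?thesis by (simp add: c_def)
  qed
  have "acyclic_coloring G c" if G: "G \<in> \<S>" for G
  proof -
    have "c ` set xs = C G ` set xs" if "is_cycle G xs" for xs
      using that c[OF G] unfolding is_cycle_def by (intro image_cong) auto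
    then show ?thesis
      using C(1)[OF G] c[OF G] unfolding acyclic_coloring_iff proper_coloring_def by simp
  qed
  then have "acyclic_coloring graph_union c" by (rule acyclic_coloring_union)
  moreover have "c ` verts graph_union \<subseteq> {..<n}" using C(2) c unfolding graph_union_def by fastforce
  ultimately show ?thesis by blast
qed

section \<open>Joins: all parts but one are rainbow, or cliques of the triangulation\<close>

lemma full_join_adjacent:
  assumes "G \<in> \<S>" "H \<in> \<S>" "G \<noteq> H" "x \<in> verts G" "y \<in> verts H"
  shows "{x, y} \<in> edges full_join"
  using assms unfolding full_join_def cross_edges_def snd_conv by blast

lemma verts_subset_full_join: "G \<in> \<S> \<Longrightarrow> verts G \<subseteq> verts full_join"
  unfolding full_join_def by auto

lemma finite_full_join: "finite (verts full_join)"
  using simple_graph_Union(1)[OF finite_family simple] unfolding full_join_def by simp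

text \<open>By \<open>acyclic_coloring_inj_on_or\<close> at most one part repeats a color, and
  different parts share none because they are completely adjacent. So every vertex outside
  \<open>G\<close> costs one color of its own.\<close>

lemma full_join_acyclic_coloring_part:
  assumes c: "acyclic_coloring full_join c" and ne: "\<S> \<noteq> {}"
  obtains G where "G \<in> \<S>"
    "card (c ` verts G) + card (verts full_join - verts G) \<le> card (c ` verts full_join)"
proof -
  \<comment> \<open>Take the part that repeats a color if there is one, and any part
    otherwise.\<close>
  have "\<exists>G\<in>\<S>. \<forall>H\<in>\<S>. H \<noteq> G \<longrightarrow> inj_on c (verts H)"
  proof (cases "\<exists>G\<in>\<S>. \<not> inj_on c (verts G)")
    case True
    then obtain G where G: "G \<in> \<S>" "\<not> inj_on c (verts G)" by blast
    have "inj_on c (verts H)" if H: "H \<in> \<S>" "H \<noteq> G" for H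
      using acyclic_coloring_inj_on_or[OF c verts_subset_full_join[OF G(1)]
          verts_subset_full_join[OF H(1)]] G H disjoint full_join_adjacent by metis
    then show ?thesis using G(1) by blast
  qed (use ne in blast)
  then obtain G where G: "G \<in> \<S>" and inj: "\<And>H. H \<in> \<S> \<Longrightarrow> H \<noteq> G \<Longrightarrow> inj_on c (verts H)"
    by blast
  have differ: "c x \<noteq> c y"
    if "H \<in> \<S>" "H' \<in> \<S>" "H \<noteq> H'" "x \<in> verts H" "y \<in> verts H'" for H H' x y
  proof -
    have "x \<noteq> y" using that disjoint by blast
    moreover have "x \<in> verts full_join" "y \<in> verts full_join"
      using that verts_subset_full_join by blast+
    ultimately show ?thesis
      using c full_join_adjacent[OF that] unfolding acyclic_coloring_iff proper_coloring_def
      by blast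
  qed
  let ?B = "verts full_join - verts G"
  have B: "\<exists>H\<in>\<S>. H \<noteq> G \<and> x \<in> verts H" if "x \<in> ?B" for x
    using that unfolding full_join_def by auto
  have "inj_on c ?B"
  proof (rule inj_onI)
    fix x y assume xy: "x \<in> ?B" "y \<in> ?B" "c x = c y"
    obtain H H' where "H \<in> \<S>" "H \<noteq> G" "x \<in> verts H" "H' \<in> \<S>" "H' \<noteq> G" "y \<in> verts H'"
      using B xy by meson
    then show "x = y" using inj[of H] differ[of H H' x y] xy(3)
      by (cases "H = H'") (auto dest: inj_onD)
  qed
  then have "card (c ` ?B) = card ?B" by (rule card_image)
  moreover have "c ` verts G \<inter> c ` ?B = {}"
    using B differ[OF G] by fastforce
  moreover have "c ` verts full_join = c ` verts G \<union> c ` ?B"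
    using verts_subset_full_join[OF G] by blast
  moreover have "finite (c ` verts G)" "finite (c ` ?B)"
    using finite_full_join finite_subset[OF verts_subset_full_join[OF G]] by auto
  ultimately have "card (c ` verts full_join) = card (c ` verts G) + card ?B"
    by (simp add: card_Un_disjoint)
  then show ?thesis using that[OF G] by simp
qed

text \<open>The counterpart for triangulations: by \<open>chordal_clique_or\<close> at most one part
  fails to be a clique of \<open>T\<close>. A maximum clique of \<open>T\<close> within that part
  stays a clique when all vertices of the other parts are added.\<close>

lemma full_join_triangulation_part:
  assumes T: "triangulation full_join T" and ne: "\<S> \<noteq> {}"
  obtains G where "G \<in> \<S>"
    "\<omega> (induced T (verts G)) + card (verts full_join - verts G) \<le> \<omega> T"
proof -
  have VT: "verts T = verts full_join" and ET: "edges full_join \<subseteq> edges T" and ch: "chordal T"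
    using T unfolding triangulation_def by auto
  have adj: "{x, y} \<in> edges T"
    if "H \<in> \<S>" "H' \<in> \<S>" "H \<noteq> H'" "x \<in> verts H" "y \<in> verts H'" for H H' x y
    using full_join_adjacent[OF that] ET by blast
  have sub: "verts G \<subseteq> verts T" if "G \<in> \<S>" for G
    using verts_subset_full_join[OF that] VT by simp
  have "\<exists>G\<in>\<S>. \<forall>H\<in>\<S>. H \<noteq> G \<longrightarrow> clique (verts H) (edges T)"
  proof (cases "\<exists>G\<in>\<S>. \<not> clique (verts G) (edges T)")
    case True
    then obtain G where G: "G \<in> \<S>" "\<not> clique (verts G) (edges T)" by blast
    have "clique (verts H) (edges T)" if H: "H \<in> \<S>" "H \<noteq> G" for H
      using chordal_clique_or[OF ch sub[OF G(1)] sub[OF H(1)]] G H disjoint adj by metis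
    then show ?thesis using G(1) by blast
  qed (use ne in blast)
  then obtain G where G: "G \<in> \<S>"
    and cl: "\<And>H. H \<in> \<S> \<Longrightarrow> H \<noteq> G \<Longrightarrow> clique (verts H) (edges T)" by blast
  let ?B = "verts full_join - verts G"
  have B: "\<exists>H\<in>\<S>. H \<noteq> G \<and> x \<in> verts H" if "x \<in> ?B" for x
    using that unfolding full_join_def by auto
  have finT: "finite (verts T)" using VT finite_full_join by simp
  then have "finite (verts (induced T (verts G)))" by (simp add: induced_def)
  then obtain K where K: "K \<subseteq> verts (induced T (verts G))"
    "clique K (edges (induced T (verts G)))" "card K = \<omega> (induced T (verts G))"
    by (rule clique_number_attained)
  have KG: "K \<subseteq> verts G" and KT: "clique K (edges T)"
    using K(1,2) unfolding induced_def clique_def by auto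
  have cross: "{x, y} \<in> edges T" if "x \<in> K" "y \<in> ?B" for x y
    using that KG B adj[OF G] by blast
  have inside: "{x, y} \<in> edges T" if xy: "x \<in> ?B" "y \<in> ?B" "x \<noteq> y" for x y
  proof -
    obtain H H' where "H \<in> \<S>" "H \<noteq> G" "x \<in> verts H" "H' \<in> \<S>" "H' \<noteq> G" "y \<in> verts H'"
      using B xy by meson
    then show ?thesis
      using cl[of H] adj[of H H' x y] xy(3) by (cases "H = H'") (auto simp: clique_def)
  qed
  have "clique (K \<union> ?B) (edges T)"
    using KT cross inside unfolding clique_def by (metis UnE insert_commute)
  then have "card (K \<union> ?B) \<le> \<omega> T"
    using card_le_clique_number[OF finT, of "K \<union> ?B"] KG sub[OF G] VT by blast
  moreover have "card (K \<union> ?B) = card K + card ?B"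
    using KG finite_full_join finite_subset[OF verts_subset_full_join[OF G]]
    by (intro card_Un_disjoint) (auto intro: finite_subset)
  ultimately show ?thesis using that[OF G] K(3) by simp
qed

end

section \<open>Exchanging colorings and triangulations\<close>

text \<open>The first half bounds treewidth by colors, the second colors by treewidth. The second
  prescribes the palette \<open>{..<\<omega> H}\<close> rather than a number of colors, so that
  parts of a union can share it and a join can add fresh colors above it.\<close>

lemma cograph_exchange:
  assumes "cograph G"
  shows "(\<forall>c. acyclic_coloring G c \<longrightarrow> (\<exists>H. triangulation G H \<and> \<omega> H \<le> card (c ` verts G))) \<and>
    (\<forall>H. triangulation G H \<longrightarrow> (\<exists>c. acyclic_coloring G c \<and> c ` verts G \<subseteq> {..<\<omega> H}))"
  using assms
proof induction
  case (single v)
  let ?G = "({v}, {}) :: 'a graph"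
  have no_cycle: "\<not> is_cycle ?G xs" for xs unfolding is_cycle_def by force
  have T: "triangulation ?G ?G"
    using no_cycle unfolding triangulation_def simple_graph_def chordal_def by simp
  have "\<omega> ?G \<le> card (c ` verts ?G)" for c :: "'a \<Rightarrow> nat"
  proof -
    obtain K where "K \<subseteq> {v}" "card K = \<omega> ?G" using clique_number_attained[of ?G] by auto
    then show ?thesis using card_mono[of "{v}" K] by simp
  qed
  moreover have "acyclic_coloring ?G (\<lambda>_. 0)"
    using no_cycle unfolding acyclic_coloring_iff proper_coloring_def by simp
  \<comment> \<open>This puts the color 0 of the constant coloring into the palette.\<close>
  moreover have "0 < \<omega> H" if "triangulation ?G H" for H
    using that clique_number_pos[OF triangulation_finite[OF that]]
    unfolding triangulation_def by simp
  ultimately show ?case using T by fastforce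
next
  case (disjoint_union \<S>)
  interpret disjoint_family_of_graphs \<S>
    by standard (use disjoint_union.hyps cograph_simple_graph(1) in blast)+
  have V: "verts G \<subseteq> verts graph_union" if "G \<in> \<S>" for G using that unfolding graph_union_def by auto
  have fin: "finite (verts graph_union)" using simple_graph_union unfolding simple_graph_def by blast
  have "\<exists>H. triangulation graph_union H \<and> \<omega> H \<le> card (c ` verts graph_union)"
    if c: "acyclic_coloring graph_union c" for c
  proof (rule union_triangulation)
    fix G assume G: "G \<in> \<S>"
    have "acyclic_coloring G c"
      using acyclic_coloring_induced[OF c, of "verts G"] induced_union[OF G] by simp
    then obtain H where "triangulation G H" "\<omega> H \<le> card (c ` verts G)"
      using disjoint_union.IH[OF G] by blast
    moreover have "card (c ` verts G) \<le> card (c ` verts graph_union)"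
      using V[OF G] fin by (intro card_mono) auto
    ultimately show "\<exists>H. triangulation G H \<and> \<omega> H \<le> card (c ` verts graph_union)"
      using le_trans by blast
  qed
  moreover have "\<exists>c. acyclic_coloring graph_union c \<and> c ` verts graph_union \<subseteq> {..<\<omega> H}"
    if H: "triangulation graph_union H" for H
  proof (rule union_acyclic_coloring)
    fix G assume G: "G \<in> \<S>"
    have "triangulation G (induced H (verts G))"
      using triangulation_induced[OF H, of "verts G"] induced_union[OF G] by simp
    then obtain c where c: "acyclic_coloring G c" "c ` verts G \<subseteq> {..<\<omega> (induced H (verts G))}"
      using disjoint_union.IH[OF G] by blast
    have "\<omega> (induced H (verts G)) \<le> \<omega> H"
      by (rule clique_number_induced_le[OF triangulation_finite[OF H]])
    then show "\<exists>c. acyclic_coloring G c \<and> c ` verts G \<subseteq> {..<\<omega> H}"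
      using c by force
  qed
  ultimately show ?case unfolding graph_union_def by blast
next
  case (join \<S>)
  interpret disjoint_family_of_graphs \<S>
    by standard (use join.hyps cograph_simple_graph(1) in blast)+
  have simple: "simple_graph full_join"
    using cograph_simple_graph(1)[OF cograph.join[of \<S>]] join.hyps
    unfolding full_join_def by blast
  have split: "verts full_join = verts G \<union> (verts full_join - verts G)" if "G \<in> \<S>" for G
    using verts_subset_full_join[OF that] by blast
  have "\<exists>H. triangulation full_join H \<and> \<omega> H \<le> card (c ` verts full_join)"
    if c: "acyclic_coloring full_join c" for c
  proof -
    \<comment> \<open>Only this part goes through the induction hypothesis. The other vertices
      become universal, and \<open>le\<close> shows that the coloring already paid one color for
      each.\<close>
    obtain G where G: "G \<in> \<S>" and le:
      "card (c ` verts G) + card (verts full_join - verts G) \<le> card (c ` verts full_join)"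
      using full_join_acyclic_coloring_part[OF c join.hyps(2)] .
    have "acyclic_coloring G c"
      using acyclic_coloring_induced[OF c, of "verts G"] induced_full_join[OF G] by simp
    then obtain H where H: "triangulation G H" "\<omega> H \<le> card (c ` verts G)"
      using join.IH[OF G] by blast
    have "triangulation (induced full_join (verts G)) H"
      using H(1) induced_full_join[OF G] by simp
    from triangulation_extend[OF simple split[OF G] _ this]
    obtain H' where "triangulation full_join H'"
      "\<omega> H' \<le> \<omega> H + card (verts full_join - verts G)" by blast
    then show ?thesis using H(2) le by (intro exI[of _ H']) simp
  qed
  moreover have "\<exists>c. acyclic_coloring full_join c \<and> c ` verts full_join \<subseteq> {..<\<omega> H}"
    if H: "triangulation full_join H" for H
  proof -
    \<comment> \<open>Dually, each vertex outside \<open>G\<close> gets a private color, paid for by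
      its place in a large clique of \<open>H\<close>.\<close>
    obtain G where G: "G \<in> \<S>" and le:
      "\<omega> (induced H (verts G)) + card (verts full_join - verts G) \<le> \<omega> H"
      using full_join_triangulation_part[OF H join.hyps(2)] .
    have "triangulation G (induced H (verts G))"
      using triangulation_induced[OF H, of "verts G"] induced_full_join[OF G] by simp
    then obtain c where c: "acyclic_coloring G c" "c ` verts G \<subseteq> {..<\<omega> (induced H (verts G))}"
      using join.IH[OF G] by blast
    have "acyclic_coloring (induced full_join (verts G)) c"
      using c(1) induced_full_join[OF G] by simp
    from acyclic_coloring_extend[OF simple split[OF G] _ this c(2)]
    obtain c' where "acyclic_coloring full_join c'" "c' ` verts full_join
      \<subseteq> {..<\<omega> (induced H (verts G)) + card (verts full_join - verts G)}" by blast
    then show ?thesis using le by (intro exI[of _ c']) force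
  qed
  ultimately show ?case unfolding full_join_def by blast
qed

text \<open>Extending the empty graph by all vertices of \<open>G\<close> as universal ones gives
  the complete graph. It ensures that the minimum defining \<open>tw\<close> is attained.\<close>

lemma triangulation_exists:
  assumes "simple_graph G"
  shows "\<exists>H. triangulation G H"
proof -
  have "induced G {} = ({}, {})"
    using assms unfolding induced_def simple_graph_def by (auto simp: nsets_def)
  moreover have "triangulation ({}, {}) ({}, {})"
    unfolding triangulation_def simple_graph_def chordal_def is_cycle_def by auto
  ultimately have "triangulation (induced G {}) ({}, {})" by simp
  then show ?thesis
    by (rule triangulation_extend[OF assms, of "{}" "verts G", rotated 2]) auto
qed

theorem theorem4:
  fixes G :: "'a graph"
  assumes "cograph G"
  shows "\<chi>\<^sub>a G = tw G + 1"
proof -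
  have simple: "simple_graph G" and ne: "verts G \<noteq> {}"
    using cograph_simple_graph[OF assms] .
  have fin: "finite (verts G)" using simple unfolding simple_graph_def by blast
  have "\<exists>k H. triangulation G H \<and> \<omega> H - 1 = k" using triangulation_exists[OF simple] by blast
  then have "\<exists>H. triangulation G H \<and> \<omega> H - 1 = tw G"
    unfolding treewidth_def by (rule LeastI_ex)
  then obtain H where H: "triangulation G H" "\<omega> H - 1 = tw G" by blast
  obtain c where c: "acyclic_coloring G c" "c ` verts G \<subseteq> {..<\<omega> H}"
    using cograph_exchange[OF assms] H(1) by blast
  have "\<chi>\<^sub>a G \<le> card (c ` verts G)"
    unfolding acyclic_chromatic_number_def by (rule Least_le) (use c(1) in blast)
  also have "\<dots> \<le> \<omega> H" using card_mono[OF _ c(2)] by simp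
  finally have upper: "\<chi>\<^sub>a G \<le> tw G + 1" using H(2) by simp
  have "\<exists>k c. acyclic_coloring G c \<and> card (c ` verts G) = k" using c(1) by blast
  then have "\<exists>c. acyclic_coloring G c \<and> card (c ` verts G) = \<chi>\<^sub>a G"
    unfolding acyclic_chromatic_number_def by (rule LeastI_ex)
  then obtain d where d: "acyclic_coloring G d" "card (d ` verts G) = \<chi>\<^sub>a G" by blast
  then obtain T where T: "triangulation G T" "\<omega> T \<le> \<chi>\<^sub>a G"
    using cograph_exchange[OF assms] by metis
  have "tw G \<le> \<omega> T - 1"
    unfolding treewidth_def by (rule Least_le) (use T(1) in blast)
  \<comment> \<open>Positivity is what turns the bound by the truncated difference
    \<open>\<omega> T - 1\<close> into \<open>tw G + 1 \<le> \<chi>\<^sub>a G\<close>.\<close>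
  moreover have "0 < \<chi>\<^sub>a G" using d(2) fin ne by (metis card_gt_0_iff finite_imageI image_is_empty)
  ultimately show ?thesis using upper T(2) by linarith
qed

end
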